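(* For each $k\ge1$ let $U_k$ be uniform on $\{0,1,\dots,k\}$ and set $X_k=2^{U_k}$, $Y_k=2^{k-U_k}$. Let $U$ be uniform on $(0,1)$. Then, as $k\to\infty$, the following convergences in distribution hold: \begin{align*} \tfrac1k\log_2 b(C_{X_k,Y_k}) &\to f(U),\\ \tfrac1k\log_2 \min\{b(C_{X_k,Y_k}),\,b(C_{Y_k,X_k})\} &\to g(U),\\ \tfrac1k\log_2 b(P_{X_k}\,\square\,P_{Y_k}) &\to h(U),\\ \tfrac1k\log_2 b(P_{X_k}\boxtimes P_{Y_k}) &\to h(U), \end{align*} where $g(x)=\min\{f(x),f(1-x)\}$, \[ f(x)=\begin{cases}1/2,&0\le x\le 1/2,\\ 1-x,&1/2\le x\le 2/3,\\ x/2,&2/3\le x\le1,\end{cases}\qquad h(x)=\begin{cases}(1-x)/2,&0\le x\le 1/3,\\ 1/3,&1/3\le x\le 2/3,\\ x/2,&2/3\le x\le1.\end{cases} \]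
   Context: The burning number of a graph $G$ is $b(G)=\min\{k : \exists v_1,\dots,v_k\in V(G) \text{ with } V(G)=\bigcup_{i=1}^k B(v_i,k-i)\}$, where $B(v,r)$ is the set of vertices at graph distance at most $r$ from $v$. The comb graph $C_{n,m}$ has vertex set $\{(i,j): 1\le i\le m,\ 1\le j\le n\}$ with edges $(1,j)\sim(1,j+1)$ for $1\le j<n$ (the spine) and $(i,j)\sim(i+1,j)$ for $1\le i<m$ (tooth $j$). $P_n$ is the path on $n$ vertices; $\square$ denotes the Cartesian product and $\boxtimes$ the strong product of graphs. *)

theory Defs
  imports "HOL-Probability.Probability" "Graph_Theory.Pair_Digraph" "Graph_Theory.Shortest_Path"
begin

section \<open>Distance and burning number\<close>

text \<open>Undirected graphs are symmetric loop-free digraphs without parallel arcs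
  (locale \<^locale>\<open>pair_graph\<close>).  The graph distance is the shortest-path length with
  unit weights, infinite between different components.\<close>

definition graph_dist :: "'a pair_pre_digraph \<Rightarrow> 'a \<Rightarrow> 'a \<Rightarrow> ereal" where
  "graph_dist G u v = wf_digraph.\<mu> (with_proj G) (\<lambda>_. 1) u v"

definition graph_ball :: "'a pair_pre_digraph \<Rightarrow> 'a \<Rightarrow> nat \<Rightarrow> 'a set" where
  "graph_ball G v r = {u \<in> pverts G. graph_dist G v u \<le> ereal (real r)}"

definition burning_number :: "'a pair_pre_digraph \<Rightarrow> nat" where
  "burning_number G =
    (LEAST k. \<exists>v :: nat \<Rightarrow> 'a. (\<forall>i\<in>{1..k}. v i \<in> pverts G) \<and>
      pverts G = (\<Union>i\<in>{1..k}. graph_ball G (v i) (k - i)))"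

section \<open>Paths, combs and graph products\<close>

definition undirected :: "'a set \<Rightarrow> 'a rel \<Rightarrow> 'a pair_pre_digraph" where
  "undirected V E = \<lparr>pverts = V, parcs = E \<union> E\<inverse>\<rparr>"

definition path_graph :: "nat \<Rightarrow> nat pair_pre_digraph" where
  "path_graph n = undirected {1..n} {(i, i + 1) | i. 1 \<le> i \<and> i < n}"

text \<open>The comb has \<open>n\<close> teeth with \<open>m\<close> vertices each; the vertex \<open>(i, j)\<close> is the \<open>i\<close>-th
  vertex of tooth \<open>j\<close>, and the spine is \<open>i = 1\<close>.  It is meaningful for \<open>m \<ge> 1\<close>.\<close>

definition comb_graph :: "nat \<Rightarrow> nat \<Rightarrow> (nat \<times> nat) pair_pre_digraph" where
  "comb_graph n m = undirected {(i, j). 1 \<le> i \<and> i \<le> m \<and> 1 \<le> j \<and> j \<le> n}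
    ({((1, j), (1, j + 1)) | j. 1 \<le> j \<and> j < n} \<union>
     {((i, j), (i + 1, j)) | i j. 1 \<le> i \<and> i < m \<and> 1 \<le> j \<and> j \<le> n})"

definition cartesian_product ::
  "'a pair_pre_digraph \<Rightarrow> 'b pair_pre_digraph \<Rightarrow> ('a \<times> 'b) pair_pre_digraph" where
  "cartesian_product G H = \<lparr>pverts = pverts G \<times> pverts H,
     parcs = {((u, v), (u', v')) | u v u' v'.
       (u = u' \<and> u \<in> pverts G \<and> (v, v') \<in> parcs H) \<or>
       (v = v' \<and> v \<in> pverts H \<and> (u, u') \<in> parcs G)}\<rparr>"

definition strong_product ::
  "'a pair_pre_digraph \<Rightarrow> 'b pair_pre_digraph \<Rightarrow> ('a \<times> 'b) pair_pre_digraph" where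
  "strong_product G H = \<lparr>pverts = pverts G \<times> pverts H,
     parcs = {((u, v), (u', v')) | u v u' v'.
       u \<in> pverts G \<and> u' \<in> pverts G \<and> v \<in> pverts H \<and> v' \<in> pverts H \<and> (u, v) \<noteq> (u', v') \<and>
       (u = u' \<or> (u, u') \<in> parcs G) \<and> (v = v' \<or> (v, v') \<in> parcs H)}\<rparr>"

lemma pair_graphI:
  assumes "finite (pverts G)" "parcs G \<subseteq> pverts G \<times> pverts G"
    "sym (parcs G)" "irrefl (parcs G)"
  shows "pair_graph G"
proof -
  have "finite (parcs G)"
    using assms(1,2) by (meson finite_SigmaI finite_subset)
  then show ?thesis
    using assms by unfold_locales (auto simp: symmetric_def irrefl_def)
qed

lemma pair_graph_path_graph: "pair_graph (path_graph n)"
  by (rule pair_graphI) (auto simp: path_graph_def undirected_def sym_def irrefl_def)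

lemma pair_graph_comb_graph:
  assumes "1 \<le> m"
  shows "pair_graph (comb_graph n m)"
proof (rule pair_graphI)
  have "{(i, j). 1 \<le> i \<and> i \<le> m \<and> 1 \<le> j \<and> j \<le> n} = {1..m} \<times> {1..n}"
    by auto
  then show "finite (pverts (comb_graph n m))"
    by (simp add: comb_graph_def undirected_def)
qed (use assms in \<open>auto simp: comb_graph_def undirected_def sym_def irrefl_def\<close>)

lemma pair_graphD:
  assumes "pair_graph G"
  shows "finite (pverts G)"
    and "(u, v) \<in> parcs G \<Longrightarrow> u \<in> pverts G \<and> v \<in> pverts G \<and> u \<noteq> v \<and> (v, u) \<in> parcs G"
proof -
  interpret pair_graph G by fact
  show "finite (pverts G)" by (rule pair_finite_verts)
  assume "(u, v) \<in> parcs G"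
  then show "u \<in> pverts G \<and> v \<in> pverts G \<and> u \<noteq> v \<and> (v, u) \<in> parcs G"
    using pair_sym_arcs in_arcsD1 in_arcsD2 pair_no_loops
    by (fastforce simp: symmetric_def sym_def)
qed

lemma pair_graph_cartesian_product:
  assumes "pair_graph G" "pair_graph H"
  shows "pair_graph (cartesian_product G H)"
  using pair_graphD[OF assms(1)] pair_graphD[OF assms(2)]
  by (intro pair_graphI) (auto simp: cartesian_product_def sym_def irrefl_def)

lemma pair_graph_strong_product:
  assumes "pair_graph G" "pair_graph H"
  shows "pair_graph (strong_product G H)"
  using pair_graphD[OF assms(1)] pair_graphD[OF assms(2)]
  by (intro pair_graphI) (auto simp: strong_product_def sym_def irrefl_def)

lemma graph_ball_iff_walk:
  assumes "pair_graph G"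
  shows "u \<in> graph_ball G v r \<longleftrightarrow>
    u \<in> pverts G \<and> (\<exists>p. pre_digraph.awalk (with_proj G) v p u \<and> length p \<le> r)"
proof -
  interpret pair_graph G by fact
  have cost: "awalk_cost (\<lambda>_. 1) p = real (length p)" for p :: "('a \<times> 'a) list"
    by (induction p) auto
  have dist: "graph_dist G v u = (INF p\<in>{p. awalk v p u}. ereal (real (length p)))"
    by (simp add: graph_dist_def \<mu>_def cost)
  have "(\<exists>p. awalk v p u \<and> length p \<le> r)" if le: "graph_dist G v u \<le> ereal (real r)"
  proof -
    have "ereal (real r) < ereal (real (Suc r))"
      by simp
    with le have "(INF p\<in>{p. awalk v p u}. ereal (real (length p))) < ereal (real (Suc r))"
      unfolding dist by (rule le_less_trans)
    then obtain p where "awalk v p u" "length p < Suc r"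
      by (auto simp: INF_less_iff)
    then show ?thesis by auto
  qed
  moreover have "graph_dist G v u \<le> ereal (real r)" if "awalk v p u" "length p \<le> r" for p
    unfolding dist using that by (intro INF_lower2[of p]) auto
  ultimately show ?thesis
    by (auto simp: graph_ball_def)
qed

lemma burning_number_witness:
  assumes "pair_graph G"
  shows "\<exists>v :: nat \<Rightarrow> 'a. (\<forall>i\<in>{1..burning_number G}. v i \<in> pverts G) \<and>
    pverts G = (\<Union>i\<in>{1..burning_number G}. graph_ball G (v i) (burning_number G - i))"
  unfolding burning_number_def
proof (rule LeastI)
  interpret pair_graph G by fact
  obtain w where w: "bij_betw w {1..card (pverts G)} (pverts G)"
    using ex_bij_betw_nat_finite_1[OF pair_finite_verts] by auto
  let ?k = "card (pverts G)"
  have self: "u \<in> graph_ball G u r" if "u \<in> pverts G" for u r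
    using that by (auto simp: graph_ball_iff_walk[OF assms] awalk_Nil_iff intro!: exI[of _ "[]"])
  have "(\<forall>i\<in>{1..?k}. w i \<in> pverts G) \<and>
      pverts G = (\<Union>i\<in>{1..?k}. graph_ball G (w i) (?k - i))"
  proof (intro conjI equalityI subsetI)
    fix x assume "x \<in> pverts G"
    then obtain i where "i \<in> {1..?k}" "x = w i"
      using w unfolding bij_betw_def by blast
    then show "x \<in> (\<Union>i\<in>{1..?k}. graph_ball G (w i) (?k - i))"
      using self \<open>x \<in> pverts G\<close> by blast
  qed (use w in \<open>auto simp: bij_betw_def graph_ball_def\<close>)
  then show "\<exists>v. (\<forall>i\<in>{1..?k}. v i \<in> pverts G) \<and>
      pverts G = (\<Union>i\<in>{1..?k}. graph_ball G (v i) (?k - i))"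
    by blast
qed

section \<open>The limit functions\<close>

text \<open>Only the values on \<open>[0, 1]\<close> are relevant.\<close>

definition f_lim :: "real \<Rightarrow> real" where
  "f_lim x = (if x \<le> 1/2 then 1/2 else if x \<le> 2/3 then 1 - x else x/2)"

definition g_lim :: "real \<Rightarrow> real" where
  "g_lim x = min (f_lim x) (f_lim (1 - x))"

definition h_lim :: "real \<Rightarrow> real" where
  "h_lim x = (if x \<le> 1/3 then (1 - x)/2 else if x \<le> 2/3 then 1/3 else x/2)"

end

theory Submission
  imports Defs "HOL-Real_Asymp.Real_Asymp"
begin

text \<open>Up to constant factors, the burning number of the comb with \<open>n\<close> teeth of \<open>m\<close> vertices is
  \<open>max (min (sqrt (n m)) m) (sqrt n)\<close>, and that of either \<open>n \<times> m\<close> grid is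
  \<open>max (root 3 (n m)) (max (sqrt n) (sqrt m))\<close>.  The lower bounds come from counting how many
  vertices of a suitable set a ball of radius \<open>r\<close> can contain (at most \<open>2 r + 1\<close> on the spine, in
  the upper halves of the teeth, or on a side of the grid; at most \<open>(2 r + 1)\<^sup>2\<close> in the strong grid),
  the upper bounds from explicit coverings by equally spaced balls of equal radius.  For
  \<open>n = 2 ^ u\<close>, \<open>m = 2 ^ (k - u)\<close> the binary logarithm of the burning number is therefore within a
  constant of \<open>k\<close> times the limit function at \<open>u / k\<close>.  If \<open>V\<close> is uniform on \<open>(0, 1)\<close>, then
  \<open>\<lfloor>(k + 1) V\<rfloor>\<close> is uniform on \<open>{0..k}\<close>; in this coupling the scaled logarithms converge pointwise,
  so their laws converge weakly.\<close>

section \<open>Balls\<close>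

lemma graph_ball_subset_pverts: "graph_ball G v r \<subseteq> pverts G"
  by (auto simp: graph_ball_def)

lemma graph_ball_mono: "r \<le> s \<Longrightarrow> graph_ball G v r \<subseteq> graph_ball G v s"
  by (auto simp: graph_ball_def intro: order_trans)

lemma center_in_graph_ball:
  assumes "pair_graph G" "v \<in> pverts G"
  shows "v \<in> graph_ball G v r"
proof -
  interpret pair_graph G by fact
  show ?thesis
    using assms(2)
    by (auto simp: graph_ball_iff_walk[OF assms(1)] awalk_Nil_iff intro!: exI[of _ "[]"])
qed

lemma graph_ball_step:
  assumes "pair_graph G" "u \<in> graph_ball G v r" "(u, w) \<in> parcs G"
  shows "w \<in> graph_ball G v (Suc r)"
proof -
  interpret pair_graph G by fact
  obtain p where p: "awalk v p u" "length p \<le> r"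
    using assms(2) by (auto simp: graph_ball_iff_walk[OF assms(1)])
  have w: "w \<in> pverts G"
    using pair_graphD(2)[OF assms(1,3)] by simp
  then have "awalk u [(u, w)] w"
    using assms(3) by (simp add: awalk_simps)
  with p have "awalk v (p @ [(u, w)]) w"
    by (blast intro: awalk_appendI)
  with p w show ?thesis
    by (force simp: graph_ball_iff_walk[OF assms(1)] intro!: exI[of _ "p @ [(u, w)]"])
qed

lemma graph_ball_walk:
  assumes "pair_graph G" "x 0 \<in> graph_ball G v r"
    and "\<And>i. i < d \<Longrightarrow> (x i, x (Suc i)) \<in> parcs G"
  shows "x d \<in> graph_ball G v (r + d)"
  using assms(3)
proof (induction d)
  case (Suc d)
  then show ?case
    using graph_ball_step[OF assms(1), of "x d" v "r + d" "x (Suc d)"] by simp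
qed (use assms(2) in simp)

text \<open>Induction along a walk from its last arc. The radius only bounds the walk length from
  above, hence \<open>center\<close> must hold for every radius.\<close>

lemma graph_ball_induct [consumes 2, case_names center step]:
  assumes "pair_graph G" "u \<in> graph_ball G v r"
    and center: "\<And>r. v \<in> pverts G \<Longrightarrow> P v r"
    and step: "\<And>u w r. P u r \<Longrightarrow> (u, w) \<in> parcs G \<Longrightarrow> P w (Suc r)"
  shows "P u r"
proof -
  interpret pair_graph G by fact
  have "P u s" if "awalk v p u" "length p \<le> s" for p u s
    using that
  proof (induction p arbitrary: u s rule: rev_induct)
    case Nil
    then show ?case using center[of s] by (auto simp: awalk_Nil_iff)
  next
    case (snoc e p)
    obtain s' where s: "s = Suc s'" "length p \<le> s'"
      using snoc.prems(2) by (cases s) auto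
    obtain a b where e: "e = (a, b)" by force
    have "awalk v p a" "(a, b) \<in> parcs G" "b = u"
      using snoc.prems(1) by (auto simp: e awalk_simps)
    with snoc.IH[of a s'] s step show ?case by blast
  qed
  then show ?thesis
    using assms(2) by (auto simp: graph_ball_iff_walk[OF assms(1)])
qed

text \<open>A potential that changes by at most 1 along each arc bounds distances from below. All
  lower bounds on burning numbers rest on a choice of such a potential.\<close>

lemma Lipschitz_on_graph_ball:
  fixes \<phi> :: "'a \<Rightarrow> int"
  assumes "pair_graph G" "u \<in> graph_ball G v r"
    and Lip: "\<And>a b. (a, b) \<in> parcs G \<Longrightarrow> \<bar>\<phi> a - \<phi> b\<bar> \<le> 1"
  shows "\<bar>\<phi> u - \<phi> v\<bar> \<le> int r"
  using assms(1,2)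
proof (induction rule: graph_ball_induct)
  case (step u w r)
  from Lip[OF step(2)] step(1) show ?case by simp
qed simp

text \<open>The potential embeds this part of the ball into an integer interval with
  \<open>2 * r + 1\<close> elements, so \<open>S\<close> meets balls as sparsely as a path
  does.\<close>

lemma card_graph_ball_Lipschitz_le:
  fixes \<phi> :: "'a \<Rightarrow> int"
  assumes "pair_graph G"
    and "\<And>a b. (a, b) \<in> parcs G \<Longrightarrow> \<bar>\<phi> a - \<phi> b\<bar> \<le> 1"
    and inj: "inj_on \<phi> (S \<inter> graph_ball G v r)"
  shows "card (S \<inter> graph_ball G v r) \<le> 2 * r + 1"
proof -
  have "\<phi> ` (S \<inter> graph_ball G v r) \<subseteq> {\<phi> v - int r..\<phi> v + int r}"
    using Lipschitz_on_graph_ball[of G _ v r \<phi>] assms(1,2) by force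
  then have "card (\<phi> ` (S \<inter> graph_ball G v r)) \<le> card {\<phi> v - int r..\<phi> v + int r}"
    by (intro card_mono) auto
  with inj show ?thesis
    by (simp add: card_image)
qed

section \<open>General bounds for burning numbers\<close>

lemma burning_number_pos:
  assumes "pair_graph G" "pverts G \<noteq> {}"
  shows "burning_number G > 0"
proof (rule ccontr)
  assume "\<not> burning_number G > 0"
  then show False
    using burning_number_witness[OF assms(1)] assms(2) by auto
qed

text \<open>Additional arcs only enlarge balls, so a burning sequence of \<open>G\<close> also burns
  \<open>H\<close>.\<close>

lemma burning_number_le_spanning_subgraph:
  assumes "pair_graph G" "pair_graph H" "pverts G = pverts H" "parcs G \<subseteq> parcs H"
  shows "burning_number H \<le> burning_number G"
proof -
  have ball: "graph_ball G v r \<subseteq> graph_ball H v r" for v r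
  proof
    fix u assume "u \<in> graph_ball G v r"
    with assms(1) show "u \<in> graph_ball H v r"
    proof (induction rule: graph_ball_induct)
      case (center r)
      then show ?case using assms center_in_graph_ball by metis
    next
      case (step u w r)
      then show ?case using assms graph_ball_step by (metis subsetD)
    qed
  qed
  obtain v where v: "\<forall>i\<in>{1..burning_number G}. v i \<in> pverts G"
    "pverts G = (\<Union>i\<in>{1..burning_number G}. graph_ball G (v i) (burning_number G - i))"
    using burning_number_witness[OF assms(1)] by blast
  have "pverts H = (\<Union>i\<in>{1..burning_number G}. graph_ball H (v i) (burning_number G - i))"
  proof (rule equalityI)
    show "pverts H \<subseteq> (\<Union>i\<in>{1..burning_number G}. graph_ball H (v i) (burning_number G - i))"
      unfolding assms(3)[symmetric] by (subst v(2)) (intro UN_mono order_refl ball)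
  qed (intro UN_least graph_ball_subset_pverts)
  moreover have "\<forall>i\<in>{1..burning_number G}. v i \<in> pverts H"
    using v(1) unfolding assms(3) .
  ultimately show ?thesis
    unfolding burning_number_def[of H] by (intro Least_le exI conjI)
qed

text \<open>In a burning sequence of length \<open>N + r\<close>, the first \<open>N\<close> balls have radius at least \<open>r\<close>.\<close>

lemma burning_number_le_add:
  assumes "pverts G \<noteq> {}" "finite D" "card D \<le> N"
    and "\<And>v. v \<in> pverts G \<Longrightarrow> \<exists>d\<in>D. c d \<in> pverts G \<and> v \<in> graph_ball G (c d) r"
  shows "burning_number G \<le> N + r"
proof -
  obtain v0 where v0: "v0 \<in> pverts G" using assms(1) by auto
  obtain w where w: "bij_betw w {1..card D} D"
    using ex_bij_betw_nat_finite_1[OF assms(2)] by auto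
  \<comment> \<open>The default \<open>v0\<close> fills the positions after the first
    \<open>card D\<close> and replaces values of \<open>c\<close> that are no vertices; such
    positions never serve to cover anything.\<close>
  define v where "v i = (if i \<in> {1..card D} \<and> c (w i) \<in> pverts G then c (w i) else v0)" for i
  have "pverts G = (\<Union>i\<in>{1..N + r}. graph_ball G (v i) (N + r - i))"
  proof (intro equalityI subsetI)
    fix x assume "x \<in> pverts G"
    then obtain d where d: "d \<in> D" "c d \<in> pverts G" "x \<in> graph_ball G (c d) r"
      using assms(4) by blast
    then obtain i where i: "i \<in> {1..card D}" "d = w i"
      using w unfolding bij_betw_def by blast
    have "r \<le> N + r - i" using i assms(3) by auto
    from graph_ball_mono[OF this, of G "c d"] have "x \<in> graph_ball G (v i) (N + r - i)"
      using d i by (auto simp: v_def)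
    then show "x \<in> (\<Union>i\<in>{1..N + r}. graph_ball G (v i) (N + r - i))"
      using i assms(3) by force
  qed (use graph_ball_subset_pverts[of G] in blast)
  moreover have "\<forall>i\<in>{1..N + r}. v i \<in> pverts G"
    using v0 by (simp add: v_def)
  ultimately show ?thesis
    unfolding burning_number_def by (intro Least_le) blast
qed

text \<open>Union bound over an optimal burning sequence, whose radii run through each of 0, ...,
  \<open>burning_number G\<close> - 1 once.\<close>

lemma card_le_sum_burning:
  assumes "pair_graph G" "S \<subseteq> pverts G"
    and "\<And>v r. v \<in> pverts G \<Longrightarrow> r < burning_number G \<Longrightarrow> card (S \<inter> graph_ball G v r) \<le> c r"
  shows "card S \<le> (\<Sum>r<burning_number G. c r)"
proof -
  define b where "b = burning_number G"
  obtain v where v: "\<forall>i\<in>{1..b}. v i \<in> pverts G"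
    "pverts G = (\<Union>i\<in>{1..b}. graph_ball G (v i) (b - i))"
    using burning_number_witness[OF assms(1)] unfolding b_def by blast
  have "S = (\<Union>i\<in>{1..b}. S \<inter> graph_ball G (v i) (b - i))"
    using v(2) assms(2) by auto
  then have "card S \<le> (\<Sum>i\<in>{1..b}. card (S \<inter> graph_ball G (v i) (b - i)))"
    using card_UN_le[of "{1..b}" "\<lambda>i. S \<inter> graph_ball G (v i) (b - i)"] by simp
  also have "\<dots> \<le> (\<Sum>i\<in>{1..b}. c (b - i))"
    using v(1) assms(3) by (intro sum_mono) (auto simp: b_def)
  also have "\<dots> = (\<Sum>r<b. c r)"
    by (rule sum.reindex_bij_witness[of _ "\<lambda>r. b - r" "\<lambda>i. b - i"]) auto
  finally show ?thesis by (simp add: b_def)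
qed

lemma sum_odd_lessThan: "(\<Sum>r<b. 2 * r + 1) = b\<^sup>2" for b :: nat
  by (induction b) (auto simp: power2_eq_square)

lemma card_le_burning_number_square:
  assumes "pair_graph G" "S \<subseteq> pverts G"
    and "\<And>v r. v \<in> pverts G \<Longrightarrow> r < burning_number G \<Longrightarrow> card (S \<inter> graph_ball G v r) \<le> 2 * r + 1"
  shows "card S \<le> (burning_number G)\<^sup>2"
  using card_le_sum_burning[OF assms] by (simp only: sum_odd_lessThan)

section \<open>Combs\<close>

lemma pverts_comb_graph: "pverts (comb_graph n m) = {1..m} \<times> {1..n}"
  by (auto simp: comb_graph_def undirected_def)

lemma comb_tooth_arc:
  "1 \<le> i \<Longrightarrow> i < m \<Longrightarrow> 1 \<le> j \<Longrightarrow> j \<le> n \<Longrightarrow> ((i, j), (Suc i, j)) \<in> parcs (comb_graph n m)"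
  by (simp add: comb_graph_def undirected_def)

lemma comb_spine_arc:
  "1 \<le> j \<Longrightarrow> j < n \<Longrightarrow> ((1, j), (1, Suc j)) \<in> parcs (comb_graph n m)"
  by (simp add: comb_graph_def undirected_def)

lemma comb_arc_cases:
  assumes "((i, j), (i', j')) \<in> parcs (comb_graph n m)"
  shows "i = 1 \<and> i' = 1 \<and> \<bar>int j - int j'\<bar> = 1 \<or> j = j' \<and> \<bar>int i - int i'\<bar> = 1"
  using assms by (auto simp: comb_graph_def undirected_def)

text \<open>The tooth index is a 1-Lipschitz potential that is injective on the spine.\<close>

lemma comb_spine_le_burning_number_square:
  assumes "1 \<le> m"
  shows "n \<le> (burning_number (comb_graph n m))\<^sup>2"
proof -
  let ?G = "comb_graph n m" and ?S = "{1::nat} \<times> {1..n}"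
  have "card ?S \<le> (burning_number ?G)\<^sup>2"
  proof (rule card_le_burning_number_square)
    fix v r
    show "card (?S \<inter> graph_ball ?G v r) \<le> 2 * r + 1"
      by (rule card_graph_ball_Lipschitz_le[where \<phi> = "\<lambda>x. int (snd x)"])
         (use assms in \<open>auto simp: pair_graph_comb_graph inj_on_def dest: comb_arc_cases\<close>)
  qed (use assms in \<open>auto simp: pair_graph_comb_graph pverts_comb_graph\<close>)
  then show ?thesis by simp
qed

text \<open>A ball of radius at most \<open>m / 2\<close> meets the upper half of at most one tooth.\<close>

lemma comb_size_le_burning_number_square:
  assumes "1 \<le> m" "2 * burning_number (comb_graph n m) \<le> m"
  shows "n * m \<le> 2 * (burning_number (comb_graph n m))\<^sup>2"
proof -
  let ?G = "comb_graph n m" and ?S = "{m div 2<..m} \<times> {1..n}"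
  have "card ?S \<le> (burning_number ?G)\<^sup>2"
  proof (rule card_le_burning_number_square)
    fix v r assume "v \<in> pverts ?G" and r: "r < burning_number ?G"
    then obtain i0 j0 where v: "v = (i0, j0)" "1 \<le> i0"
      by (auto simp: pverts_comb_graph)
    \<comment> \<open>Signed height: the tooth \<open>j0\<close> of the centre keeps its height, all
      other teeth are folded onto the integers at most 0. A spine arc leaving \<open>j0\<close> goes
      from 1 to 0, so the potential stays 1-Lipschitz.\<close>
    define \<phi> where "\<phi> x = (if snd x = j0 then int (fst x) else 1 - int (fst x))" for x
    have G: "pair_graph ?G"
      using assms(1) by (rule pair_graph_comb_graph)
    have Lip: "\<bar>\<phi> a - \<phi> b\<bar> \<le> 1" if "(a, b) \<in> parcs ?G" for a b
      using comb_arc_cases[of "fst a" "snd a" "fst b" "snd b" n m] that by (auto simp: \<phi>_def)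
    have tooth: "j = j0" if "(i, j) \<in> ?S \<inter> graph_ball ?G v r" for i j
    proof (rule ccontr)
      assume "j \<noteq> j0"
      \<comment> \<open>Reaching another tooth at height \<open>i\<close> costs at least
        \<open>i + i0 - 1\<close>, hence at least \<open>i\<close>, which exceeds
        \<open>m div 2\<close> and therefore \<open>r\<close>.\<close>
      then have "\<bar>1 - int i - int i0\<bar> \<le> int r"
        using that Lipschitz_on_graph_ball[OF G, of "(i, j)" v r \<phi>] Lip by (auto simp: \<phi>_def v)
      moreover have "m div 2 < i" using that by auto
      ultimately show False using v(2) r assms(2) by linarith
    qed
    have "inj_on \<phi> (?S \<inter> graph_ball ?G v r)"
    proof (rule inj_onI)
      fix a b assume ab: "a \<in> ?S \<inter> graph_ball ?G v r" "b \<in> ?S \<inter> graph_ball ?G v r" "\<phi> a = \<phi> b"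
      then have "snd a = j0" "snd b = j0"
        using tooth[of "fst a" "snd a"] tooth[of "fst b" "snd b"] by simp_all
      with ab(3) show "a = b"
        by (simp add: \<phi>_def prod_eq_iff)
    qed
    then show "card (?S \<inter> graph_ball ?G v r) \<le> 2 * r + 1"
      using card_graph_ball_Lipschitz_le[OF G, of \<phi>] Lip by blast
  qed (use assms in \<open>auto simp: pair_graph_comb_graph pverts_comb_graph\<close>)
  then have le: "(m - m div 2) * n \<le> (burning_number ?G)\<^sup>2" by simp
  have "n * m \<le> n * (2 * (m - m div 2))"
    by (intro mult_left_mono) auto
  also have "\<dots> \<le> 2 * (burning_number ?G)\<^sup>2"
    using le by (simp add: algebra_simps)
  finally show ?thesis .
qed

section \<open>Coverings of combs by equally spaced balls\<close>

lemma comb_tooth_ball: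
  assumes "x \<in> {1..m}" "y \<in> {1..n}" "x + d \<le> m" "(x, y) \<in> graph_ball (comb_graph n m) v r"
  shows "(x + d, y) \<in> graph_ball (comb_graph n m) v (r + d)"
proof -
  have "pair_graph (comb_graph n m)"
    using assms by (intro pair_graph_comb_graph) auto
  then show ?thesis
    using assms comb_tooth_arc[of _ m y n]
    by (intro graph_ball_walk[where x = "\<lambda>i. (x + i, y)"]) auto
qed

lemma comb_spine_ball:
  assumes "y \<in> {1..n}" "y + d \<le> n" "1 \<le> m"
  shows "(1, y + d) \<in> graph_ball (comb_graph n m) (1, y) d"
proof -
  have G: "pair_graph (comb_graph n m)"
    using assms by (intro pair_graph_comb_graph) auto
  have "(1, y) \<in> graph_ball (comb_graph n m) (1, y) 0"
    using assms by (intro center_in_graph_ball G) (auto simp: pverts_comb_graph)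
  from graph_ball_walk[OF G, of "\<lambda>i. (1, y + i)" "(1, y)" 0 d] this
  show ?thesis
    using assms comb_spine_arc[of _ n m] by auto
qed

text \<open>Rounding loss: cutting a line of \<open>m\<close> vertices into blocks of length
  \<open>r\<close> overshoots by at most one block.\<close>

lemma mult_Suc_div_le: "r * Suc ((m - 1) div r) \<le> m + r" for m r :: nat
proof -
  have "r * ((m - 1) div r) \<le> m - 1" by (rule times_div_less_eq_dividend)
  then have "r * ((m - 1) div r) \<le> m" by linarith
  then show ?thesis by simp
qed

text \<open>Each tooth is cut into blocks of length \<open>r\<close>, with a centre at the lower end
  of each. Rounding costs at most one block per tooth, hence at most \<open>r\<close> in total since
  \<open>n \<le> r\<close>. So \<open>2 * r\<close> balls of radius \<open>r\<close> suffice; the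
  resulting bound \<open>3 * r\<close> is relaxed to the one for short teeth.\<close>

lemma burning_number_comb_le_long_teeth:
  assumes "1 \<le> m" "1 \<le> n" "n \<le> r" "n * m \<le> r\<^sup>2"
  shows "burning_number (comb_graph n m) \<le> 4 * r"
proof -
  let ?G = "comb_graph n m" and ?D = "{..(m - 1) div r} \<times> {1..n}"
  let ?c = "\<lambda>(q, j). (1 + r * q, j)"
  have G: "pair_graph ?G" using assms by (intro pair_graph_comb_graph)
  have "r * card ?D = r * Suc ((m - 1) div r) * n" by (simp add: algebra_simps)
  also have "\<dots> \<le> (m + r) * n" using mult_Suc_div_le by (intro mult_right_mono) auto
  also have "\<dots> \<le> r * (2 * r)"
    using add_mono[OF assms(4) mult_left_mono[OF assms(3), of r]]
    by (simp add: power2_eq_square algebra_simps)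
  finally have card: "card ?D \<le> 2 * r" using assms by (auto simp only: nat_mult_le_cancel_disj)
  have "burning_number ?G \<le> 2 * r + r"
  proof (rule burning_number_le_add[OF _ _ card, where c = ?c])
    fix v assume "v \<in> pverts ?G"
    then obtain i j where v: "v = (i, j)" "i \<in> {1..m}" "j \<in> {1..n}"
      by (auto simp: pverts_comb_graph)
    \<comment> \<open>Heights start at 1, so block and offset come from dividing
      \<open>i - 1\<close>.\<close>
    define q d where "q = (i - 1) div r" and "d = (i - 1) mod r"
    have i: "i = 1 + r * q + d" using v by (simp add: q_def d_def)
    have q: "(q, j) \<in> ?D" using v by (auto simp: q_def intro: div_le_mono)
    have c: "?c (q, j) \<in> pverts ?G" using v i by (auto simp: pverts_comb_graph)
    have ball: "v \<in> graph_ball ?G (?c (q, j)) (0 + d)"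
      using v i comb_tooth_ball[of "1 + r * q" m j n d "?c (q, j)" 0] center_in_graph_ball[OF G c]
      by auto
    have "d < r" using assms by (simp add: d_def)
    then have "v \<in> graph_ball ?G (?c (q, j)) r"
      using subsetD[OF graph_ball_mono ball, of r] by simp
    with q c show "\<exists>d\<in>?D. ?c d \<in> pverts ?G \<and> v \<in> graph_ball ?G (?c d) r"
      by blast
  qed (use assms in \<open>auto simp: pverts_comb_graph\<close>)
  then show ?thesis by simp
qed

text \<open>All centres lie on the spine with spacing \<open>r\<close>. Fewer than \<open>r\<close>
  steps along the spine and then fewer than \<open>r\<close> steps up a tooth reach every vertex,
  which explains the radius \<open>2 * r\<close>.\<close>

lemma burning_number_comb_le_short_teeth:
  assumes "1 \<le> m" "1 \<le> n" "m \<le> r" "n \<le> r\<^sup>2"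
  shows "burning_number (comb_graph n m) \<le> 4 * r"
proof -
  let ?G = "comb_graph n m" and ?D = "{..(n - 1) div r}"
  let ?c = "\<lambda>q. (1::nat, 1 + r * q)"
  have "r * card ?D \<le> n + r" using mult_Suc_div_le[of r n] by simp
  also have "\<dots> \<le> r * (2 * r)"
    using add_mono[OF assms(4) le_square[of r]] by (simp add: power2_eq_square)
  finally have card: "card ?D \<le> 2 * r" using assms by (auto simp only: nat_mult_le_cancel_disj)
  have "burning_number ?G \<le> 2 * r + 2 * r"
  proof (rule burning_number_le_add[OF _ _ card, where c = ?c])
    fix v assume "v \<in> pverts ?G"
    then obtain i j where v: "v = (i, j)" "i \<in> {1..m}" "j \<in> {1..n}"
      by (auto simp: pverts_comb_graph)
    define q d where "q = (j - 1) div r" and "d = (j - 1) mod r"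
    have j: "j = 1 + r * q + d" using v by (simp add: q_def d_def)
    have q: "q \<in> ?D" using v by (auto simp: q_def intro: div_le_mono)
    have c: "?c q \<in> pverts ?G" using v j assms by (auto simp: pverts_comb_graph)
    have "(1, 1 + r * q + d) \<in> graph_ball ?G (?c q) d"
      using v j assms by (intro comb_spine_ball) auto
    then have "(1 + (i - 1), j) \<in> graph_ball ?G (?c q) (d + (i - 1))"
      using v j assms by (intro comb_tooth_ball) auto
    moreover have "d + (i - 1) \<le> 2 * r"
    proof -
      have "d < r" using assms by (simp add: d_def)
      then show ?thesis using v assms by auto
    qed
    ultimately have "v \<in> graph_ball ?G (?c q) (2 * r)"
      using v graph_ball_mono[of "d + (i - 1)" "2 * r" ?G "?c q"] by auto
    then show "\<exists>d\<in>?D. ?c d \<in> pverts ?G \<and> v \<in> graph_ball ?G (?c d) (2 * r)"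
      using q c by blast
  qed (use assms in \<open>auto simp: pverts_comb_graph\<close>)
  then show ?thesis by simp
qed

section \<open>Grids\<close>

abbreviation (input) cartesian_grid :: "nat \<Rightarrow> nat \<Rightarrow> (nat \<times> nat) pair_pre_digraph" where
  "cartesian_grid n m \<equiv> cartesian_product (path_graph n) (path_graph m)"

abbreviation (input) strong_grid :: "nat \<Rightarrow> nat \<Rightarrow> (nat \<times> nat) pair_pre_digraph" where
  "strong_grid n m \<equiv> strong_product (path_graph n) (path_graph m)"

lemma pverts_grid:
  "pverts (cartesian_grid n m) = {1..n} \<times> {1..m}" "pverts (strong_grid n m) = {1..n} \<times> {1..m}"
  by (simp_all add: cartesian_product_def strong_product_def path_graph_def undirected_def)

lemma pair_graph_grid: "pair_graph (cartesian_grid n m)" "pair_graph (strong_grid n m)"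
  by (simp_all add: pair_graph_cartesian_product pair_graph_strong_product pair_graph_path_graph)

text \<open>Because of this comparison, lower bounds are proved for the strong grid only and upper
  bounds for the Cartesian grid only.\<close>

lemma burning_number_strong_le_cartesian:
  "burning_number (strong_grid n m) \<le> burning_number (cartesian_grid n m)"
proof (rule burning_number_le_spanning_subgraph)
  show "parcs (cartesian_grid n m) \<subseteq> parcs (strong_grid n m)"
    by (auto simp: cartesian_product_def strong_product_def path_graph_def undirected_def)
qed (simp_all add: pair_graph_grid pverts_grid)

lemma strong_arc_cases:
  assumes "((x, y), (x', y')) \<in> parcs (strong_grid n m)"
  shows "\<bar>int x - int x'\<bar> \<le> 1" "\<bar>int y - int y'\<bar> \<le> 1"
  using assms by (auto simp: strong_product_def path_graph_def undirected_def)

text \<open>Both coordinates are 1-Lipschitz even along diagonal arcs, and each is injective on one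
  side of the grid.\<close>

lemma strong_side_le_burning_number_square:
  assumes "1 \<le> n" "1 \<le> m"
  shows "n \<le> (burning_number (strong_grid n m))\<^sup>2" "m \<le> (burning_number (strong_grid n m))\<^sup>2"
proof -
  let ?G = "strong_grid n m"
  have "card ({1..n} \<times> {1::nat}) \<le> (burning_number ?G)\<^sup>2"
  proof (rule card_le_burning_number_square)
    fix v r
    show "card ({1..n} \<times> {1::nat} \<inter> graph_ball ?G v r) \<le> 2 * r + 1"
      by (rule card_graph_ball_Lipschitz_le[where \<phi> = "\<lambda>x. int (fst x)"])
         (auto simp: pair_graph_grid inj_on_def dest: strong_arc_cases)
  qed (use assms in \<open>auto simp: pair_graph_grid pverts_grid\<close>)
  then show "n \<le> (burning_number ?G)\<^sup>2" by simp
  have "card ({1::nat} \<times> {1..m}) \<le> (burning_number ?G)\<^sup>2"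
  proof (rule card_le_burning_number_square)
    fix v r
    show "card ({1::nat} \<times> {1..m} \<inter> graph_ball ?G v r) \<le> 2 * r + 1"
      by (rule card_graph_ball_Lipschitz_le[where \<phi> = "\<lambda>x. int (snd x)"])
         (auto simp: pair_graph_grid inj_on_def dest: strong_arc_cases)
  qed (use assms in \<open>auto simp: pair_graph_grid pverts_grid\<close>)
  then show "m \<le> (burning_number ?G)\<^sup>2" by simp
qed

text \<open>A ball of radius \<open>r\<close> lies in a square of side \<open>2 * r + 1\<close>,
  which is at most \<open>2 * b\<close>. Each of the \<open>b\<close> balls thus has at most
  \<open>(2 * b)\<^sup>2\<close> vertices.\<close>

lemma strong_size_le_burning_number_cube:
  "n * m \<le> 4 * burning_number (strong_grid n m) ^ 3"
proof -
  let ?G = "strong_grid n m"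
  define b where "b = burning_number ?G"
  have "card (pverts ?G) \<le> (\<Sum>r<b. (2 * b)\<^sup>2)"
    unfolding b_def
  proof (rule card_le_sum_burning)
    fix v r assume r: "r < burning_number ?G"
    \<comment> \<open>Intervals of integers avoid truncated subtraction; mapping them by
      \<open>nat\<close> can only merge elements.\<close>
    let ?I = "\<lambda>a. nat ` {int a - int r..int a + int r}"
    have I: "card (?I a) \<le> 2 * r + 1" for a
      using card_image_le[of "{int a - int r..int a + int r}" nat] by simp
    have "graph_ball ?G v r \<subseteq> ?I (fst v) \<times> ?I (snd v)"
    proof
      fix u assume u: "u \<in> graph_ball ?G v r"
      have "\<bar>int (fst u) - int (fst v)\<bar> \<le> int r" "\<bar>int (snd u) - int (snd v)\<bar> \<le> int r"
        by (rule Lipschitz_on_graph_ball[OF pair_graph_grid(2) u]; auto dest: strong_arc_cases)+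
      then have "nat (int (fst u)) \<in> ?I (fst v)" "nat (int (snd u)) \<in> ?I (snd v)"
        by (intro imageI; simp; linarith)+
      then show "u \<in> ?I (fst v) \<times> ?I (snd v)"
        by (simp add: mem_Times_iff)
    qed
    then have "card (pverts ?G \<inter> graph_ball ?G v r) \<le> card (?I (fst v) \<times> ?I (snd v))"
      by (intro card_mono) auto
    also have "\<dots> \<le> (2 * r + 1) * (2 * r + 1)"
      unfolding card_cartesian_product by (intro mult_mono I) auto
    also have "\<dots> \<le> (2 * burning_number ?G)\<^sup>2"
      unfolding power2_eq_square using r by (intro mult_mono) auto
    finally show "card (pverts ?G \<inter> graph_ball ?G v r) \<le> (2 * burning_number ?G)\<^sup>2" .
  qed (auto simp: pair_graph_grid)
  then show ?thesis
    by (simp add: pverts_grid b_def power2_eq_square power3_eq_cube algebra_simps)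
qed

text \<open>The walk takes \<open>d\<close> steps in the first coordinate, then \<open>e\<close> in
  the second. Nonnegative offsets suffice because centres will be the lowest corners of
  cells.\<close>

lemma cartesian_grid_ball:
  assumes "x \<in> {1..n}" "y \<in> {1..m}" "x + d \<le> n" "y + e \<le> m"
  shows "(x + d, y + e) \<in> graph_ball (cartesian_grid n m) (x, y) (d + e)"
proof -
  let ?G = "cartesian_grid n m"
  have "(x, y) \<in> graph_ball ?G (x, y) 0"
    using assms by (intro center_in_graph_ball pair_graph_grid) (auto simp: pverts_grid)
  then have "(x + d, y) \<in> graph_ball ?G (x, y) (0 + d)"
    using assms by (intro graph_ball_walk[where x = "\<lambda>i. (x + i, y)"] pair_graph_grid)
       (auto simp: cartesian_product_def path_graph_def undirected_def)
  then have "(x + d, y + e) \<in> graph_ball ?G (x, y) (0 + d + e)"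
    using assms by (intro graph_ball_walk[where x = "\<lambda>i. (x + d, y + i)"] pair_graph_grid)
       (auto simp: cartesian_product_def path_graph_def undirected_def)
  then show ?thesis by simp
qed

text \<open>One centre per cell of side \<open>s\<close>, with radius \<open>2 * s\<close> since
  both offsets are below \<open>s\<close>. Expanding \<open>(n + s) * (m + s)\<close> gives four
  terms, each at most \<open>s ^ 3\<close> by the hypotheses, so at most \<open>4 * s\<close> cells
  occur.\<close>

lemma burning_number_cartesian_le:
  assumes "1 \<le> n" "1 \<le> m" "n * m \<le> s ^ 3" "n \<le> s\<^sup>2" "m \<le> s\<^sup>2"
  shows "burning_number (cartesian_grid n m) \<le> 6 * s"
proof -
  let ?G = "cartesian_grid n m" and ?D = "{..(n - 1) div s} \<times> {..(m - 1) div s}"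
  let ?c = "\<lambda>(p, q). (1 + s * p, 1 + s * q)"
  have s: "1 \<le> s" using assms by (cases s) auto
  have "(s * s) * card ?D = (s * Suc ((n - 1) div s)) * (s * Suc ((m - 1) div s))"
    by (simp add: algebra_simps)
  also have "\<dots> \<le> (n + s) * (m + s)" by (intro mult_mono mult_Suc_div_le) auto
  also have "\<dots> = n * m + n * s + m * s + s * s" by (simp add: algebra_simps)
  also have "\<dots> \<le> s ^ 3 + s\<^sup>2 * s + s\<^sup>2 * s + s\<^sup>2 * s"
    using assms s by (intro add_mono mult_right_mono) (auto simp: power2_eq_square)
  also have "\<dots> = (s * s) * (4 * s)" by (simp add: power2_eq_square power3_eq_cube)
  finally have card: "card ?D \<le> 4 * s" using s by (auto simp only: nat_mult_le_cancel_disj mult_eq_0_iff)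
  have "burning_number ?G \<le> 4 * s + 2 * s"
  proof (rule burning_number_le_add[OF _ _ card, where c = ?c])
    fix v assume "v \<in> pverts ?G"
    then obtain x y where v: "v = (x, y)" "x \<in> {1..n}" "y \<in> {1..m}"
      by (auto simp: pverts_grid)
    define p d q e where "p = (x - 1) div s" and "d = (x - 1) mod s"
      and "q = (y - 1) div s" and "e = (y - 1) mod s"
    have xy: "x = 1 + s * p + d" "y = 1 + s * q + e"
      using v by (simp_all add: p_def d_def q_def e_def)
    have D: "(p, q) \<in> ?D" using v by (auto simp: p_def q_def intro: div_le_mono)
    have c: "?c (p, q) \<in> pverts ?G" using v xy by (auto simp: pverts_grid)
    have "d < s" "e < s" using s by (simp_all add: d_def e_def)
    then have "d + e \<le> 2 * s" by simp
    moreover have "(1 + s * p + d, 1 + s * q + e) \<in> graph_ball ?G (?c (p, q)) (d + e)"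
      unfolding prod.case using v xy by (intro cartesian_grid_ball) auto
    ultimately have "v \<in> graph_ball ?G (?c (p, q)) (2 * s)"
      using v xy graph_ball_mono[of "d + e" "2 * s" ?G "?c (p, q)"] by auto
    with D c show "\<exists>d\<in>?D. ?c d \<in> pverts ?G \<and> v \<in> graph_ball ?G (?c d) (2 * s)"
      by blast
  qed (use assms in \<open>auto simp: pverts_grid\<close>)
  then show ?thesis by simp
qed

section \<open>Logarithmic bounds\<close>

text \<open>For \<open>n\<close> and \<open>m\<close> with exponents \<open>x\<close> and
  \<open>1 - x\<close>, the terms are the exponents of \<open>sqrt (n m)\<close>, \<open>m\<close>
  and \<open>sqrt n\<close>. This form also makes continuity evident.\<close>

lemma f_lim_eq: "f_lim x = max (min (1/2) (1 - x)) (x/2)"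
  by (auto simp: f_lim_def min_def max_def)

lemma h_lim_eq: "h_lim x = max (1/3) (max (x/2) ((1 - x)/2))"
  by (auto simp: h_lim_def max_def)

lemma mult_f_lim:
  assumes "1 \<le> k"
  shows "real k * f_lim (real u / real k) = max (min (real k / 2) (real k - real u)) (real u / 2)"
  using assms unfolding f_lim_eq by (auto simp: min_def max_def field_simps)

lemma mult_h_lim:
  assumes "1 \<le> k"
  shows "real k * h_lim (real u / real k) =
    max (real k / 3) (max (real u / 2) ((real k - real u) / 2))"
  using assms unfolding h_lim_eq by (auto simp: max_def field_simps)

text \<open>A constant factor \<open>2 ^ c\<close> in a counting bound becomes an additive constant,
  which vanishes after division by \<open>k\<close>.\<close>

lemma exponent_le_log:
  assumes "0 < b" "2 ^ a \<le> 2 ^ c * b ^ p"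
  shows "real a \<le> real c + real p * log 2 (real b)"
proof -
  have "real (2 ^ a) \<le> real (2 ^ c * b ^ p)"
    using assms(2) of_nat_le_iff by blast
  then have "log 2 (2 ^ a) \<le> log 2 (2 ^ c * real b ^ p)"
    using assms(1) by (subst log_le_cancel_iff) auto
  also have "\<dots> = real c + real p * log 2 (real b)"
    using assms(1) by (simp add: log_mult log_nat_power)
  finally show ?thesis by (simp add: log_nat_power)
qed

lemma log_le_exponent:
  assumes "0 < b" "b \<le> 2 ^ c"
  shows "log 2 (real b) \<le> real c"
proof -
  have "real b \<le> real (2 ^ c)" using assms(2) of_nat_le_iff by blast
  then have "log 2 (real b) \<le> log 2 (2 ^ c)"
    using assms(1) by (subst log_le_cancel_iff) auto
  then show ?thesis by (simp add: log_nat_power)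
qed

lemma log_burning_number_comb:
  assumes "1 \<le> k" "u \<le> k"
  shows "\<bar>1 / real k * log 2 (real (burning_number (comb_graph (2 ^ u) (2 ^ (k - u)))))
    - f_lim (real u / real k)\<bar> \<le> 4 / real k"
proof -
  define n m :: nat where "n = 2 ^ u" and "m = 2 ^ (k - u)"
  define b where "b = burning_number (comb_graph n m)"
  define z where "z = real k * f_lim (real u / real k)"
  \<comment> \<open>The covering lemmas need a natural number as radius. It will be
    \<open>2 ^ e\<close>; rounding the exponent up costs at most a factor 2.\<close>
  define e where "e = nat \<lceil>z\<rceil>"
  have z: "z = max (min (real k / 2) (real k - real u)) (real u / 2)"
    unfolding z_def using assms(1) by (rule mult_f_lim)
  have nm: "1 \<le> n" "1 \<le> m" "n * m = 2 ^ k"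
    using assms(2) by (simp_all add: n_def m_def flip: power_add)
  have b: "0 < b"
    unfolding b_def using nm by (intro burning_number_pos pair_graph_comb_graph) (auto simp: pverts_comb_graph)
  have e: "z \<le> real e" "real e \<le> z + 1"
    using assms by (auto simp: e_def z)
  have "b \<le> 4 * 2 ^ e"
  \<comment> \<open>The case split is \<open>n \<le> m\<close> against \<open>n > m\<close>. In the
    first case the minimum in \<open>z\<close> is \<open>k / 2\<close>, in the second it is
    \<open>k - u\<close>.\<close>
  proof (cases "2 * u \<le> k")
    case True
    have "real k \<le> real (2 * e)" "real u \<le> real e"
      using e(1) True assms(2) by (auto simp: z)
    then have "k \<le> 2 * e" "u \<le> e" by linarith+
    then have "n * m \<le> (2 ^ e)\<^sup>2" "n \<le> 2 ^ e"
      unfolding nm(3) unfolding n_def by (simp_all add: mult.commute flip: power_mult)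
    then show ?thesis
      unfolding b_def using nm by (intro burning_number_comb_le_long_teeth)
  next
    case False
    have "real u \<le> real (2 * e)" "real (k - u) \<le> real e"
      using e(1) False assms(2) by (auto simp: z)
    then have "u \<le> 2 * e" "k - u \<le> e" by linarith+
    then have "n \<le> (2 ^ e)\<^sup>2" "m \<le> 2 ^ e"
      unfolding n_def m_def by (simp_all add: mult.commute flip: power_mult)
    then show ?thesis
      unfolding b_def using nm by (intro burning_number_comb_le_short_teeth)
  qed
  then have "log 2 (real b) \<le> real (e + 2)"
    using b by (intro log_le_exponent) simp_all
  then have upper: "log 2 (real b) \<le> z + 4"
    using e(2) by simp
  have "real u \<le> real 0 + real 2 * log 2 (real b)"
    using comb_spine_le_burning_number_square[OF nm(2), of n] b
    by (intro exponent_le_log) (simp_all add: b_def n_def)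
  moreover have "min (real k / 2) (real k - real u) \<le> log 2 (real b) + 1"
  \<comment> \<open>Either the upper halves of the teeth can be counted, or \<open>m < 2 * b\<close>
    bounds \<open>k - u\<close> directly.\<close>
  proof (cases "2 * b \<le> m")
    case True
    then have "real k \<le> real 1 + real 2 * log 2 (real b)"
      using comb_size_le_burning_number_square[OF nm(2), of n] b
      by (intro exponent_le_log) (simp_all add: b_def flip: nm(3))
    then show ?thesis by simp
  next
    case False
    then have "real (k - u) \<le> real 1 + real 1 * log 2 (real b)"
      using b by (intro exponent_le_log) (simp_all add: m_def)
    then show ?thesis using assms(2) by (simp add: of_nat_diff)
  qed
  ultimately have "z \<le> log 2 (real b) + 4"
    using b by (auto simp: z)
  with upper have "\<bar>log 2 (real b) - z\<bar> \<le> 4" by linarith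
  then have "\<bar>log 2 (real b) - z\<bar> / real k \<le> 4 / real k"
    by (intro divide_right_mono) auto
  moreover have "1 / real k * log 2 (real b) - f_lim (real u / real k) = (log 2 (real b) - z) / real k"
    using assms(1) by (simp add: z_def field_simps)
  ultimately show ?thesis
    by (simp add: b_def n_def m_def)
qed

text \<open>Exchanging teeth and spine replaces \<open>u\<close> by \<open>k - u\<close>, that is,
  \<open>x\<close> by \<open>1 - x\<close>; taking minima preserves a common error bound.\<close>

lemma log_burning_number_comb_min:
  assumes "1 \<le> k" "u \<le> k"
  shows "\<bar>1 / real k * log 2 (real (min (burning_number (comb_graph (2 ^ u) (2 ^ (k - u))))
      (burning_number (comb_graph (2 ^ (k - u)) (2 ^ u)))))
    - g_lim (real u / real k)\<bar> \<le> 4 / real k"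
proof -
  let ?b = "burning_number (comb_graph (2 ^ u) (2 ^ (k - u)))"
  let ?b' = "burning_number (comb_graph (2 ^ (k - u)) (2 ^ u))"
  have pos: "0 < ?b" "0 < ?b'"
    by (intro burning_number_pos pair_graph_comb_graph; force simp: pverts_comb_graph)+
  have b: "\<bar>1 / real k * log 2 (real ?b) - f_lim (real u / real k)\<bar> \<le> 4 / real k"
    using assms by (rule log_burning_number_comb)
  have "real (k - u) / real k = 1 - real u / real k"
    using assms by (simp add: field_simps of_nat_diff)
  with log_burning_number_comb[of k "k - u"] assms
  have b': "\<bar>1 / real k * log 2 (real ?b') - f_lim (1 - real u / real k)\<bar> \<le> 4 / real k"
    by simp
  have "1 / real k * log 2 (real (min ?b ?b')) =
      min (1 / real k * log 2 (real ?b)) (1 / real k * log 2 (real ?b'))"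
  proof (cases "?b \<le> ?b'")
    case True
    then have "1 / real k * log 2 (real ?b) \<le> 1 / real k * log 2 (real ?b')"
      using pos by (intro mult_left_mono) auto
    with True show ?thesis by (simp add: min_def)
  next
    case False
    then have "1 / real k * log 2 (real ?b') \<le> 1 / real k * log 2 (real ?b)"
      using pos by (intro mult_left_mono) auto
    with False show ?thesis by (auto simp: min_def)
  qed
  with b b' show ?thesis
    unfolding g_lim_def by linarith
qed

lemma log_burning_number_grid:
  assumes "1 \<le> k" "u \<le> k"
  shows "\<bar>1 / real k * log 2 (real (burning_number (cartesian_grid (2 ^ u) (2 ^ (k - u)))))
      - h_lim (real u / real k)\<bar> \<le> 4 / real k" (is ?cartesian)
    and "\<bar>1 / real k * log 2 (real (burning_number (strong_grid (2 ^ u) (2 ^ (k - u)))))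
      - h_lim (real u / real k)\<bar> \<le> 4 / real k" (is ?strong)
proof -
  define n m :: nat where "n = 2 ^ u" and "m = 2 ^ (k - u)"
  define b c where "b = burning_number (strong_grid n m)"
    and "c = burning_number (cartesian_grid n m)"
  define z where "z = real k * h_lim (real u / real k)"
  define e where "e = nat \<lceil>z\<rceil>"
  have z: "z = max (real k / 3) (max (real u / 2) ((real k - real u) / 2))"
    unfolding z_def using assms(1) by (rule mult_h_lim)
  have nm: "1 \<le> n" "1 \<le> m" "n * m = 2 ^ k"
    using assms(2) by (simp_all add: n_def m_def flip: power_add)
  have b: "0 < b"
    unfolding b_def using nm by (intro burning_number_pos pair_graph_grid) (auto simp: pverts_grid)
  have bc: "b \<le> c"
    unfolding b_def c_def by (rule burning_number_strong_le_cartesian)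
  have e: "z \<le> real e" "real e \<le> z + 1"
    using assms by (auto simp: e_def z)
  have "real k \<le> real (3 * e)" "real u \<le> real (2 * e)" "real (k - u) \<le> real (2 * e)"
    using e(1) assms(2) by (auto simp: z of_nat_diff)
  then have "k \<le> 3 * e" "u \<le> 2 * e" "k - u \<le> 2 * e" by linarith+
  then have "n * m \<le> (2 ^ e) ^ 3" "n \<le> (2 ^ e)\<^sup>2" "m \<le> (2 ^ e)\<^sup>2"
    unfolding nm(3) unfolding n_def m_def by (simp_all add: mult.commute flip: power_mult)
  \<comment> \<open>The factor 6 is below \<open>2 ^ 3\<close>, hence the exponent
    \<open>e + 3\<close> below.\<close>
  then have "c \<le> 6 * 2 ^ e"
    unfolding c_def using nm by (intro burning_number_cartesian_le)
  then have "log 2 (real c) \<le> real (e + 3)"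
    using b bc by (intro log_le_exponent) (simp_all add: power_add)
  then have upper: "log 2 (real c) \<le> z + 4"
    using e(2) by simp
  have "real u \<le> real 0 + real 2 * log 2 (real b)"
    using strong_side_le_burning_number_square(1)[OF nm(1,2)] b
    by (intro exponent_le_log) (simp_all add: b_def n_def)
  moreover have "real (k - u) \<le> real 0 + real 2 * log 2 (real b)"
    using strong_side_le_burning_number_square(2)[OF nm(1,2)] b
    by (intro exponent_le_log) (simp_all add: b_def m_def)
  moreover have "real k \<le> real 2 + real 3 * log 2 (real b)"
    using strong_size_le_burning_number_cube[of n m] b
    by (intro exponent_le_log) (simp_all add: b_def flip: nm(3))
  ultimately have lower: "z \<le> log 2 (real b) + 4"
    using assms(2) by (auto simp: z of_nat_diff)
  have mono: "log 2 (real b) \<le> log 2 (real c)"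
    using b bc by simp
  \<comment> \<open>Every value between the two logarithms obeys the estimate, so its endpoints
    settle both products at once.\<close>
  have close: "\<bar>1 / real k * y - h_lim (real u / real k)\<bar> \<le> 4 / real k"
    if "log 2 (real b) \<le> y" "y \<le> log 2 (real c)" for y
  proof -
    have "\<bar>y - z\<bar> \<le> 4" using lower upper that by linarith
    then have "\<bar>y - z\<bar> / real k \<le> 4 / real k"
      by (intro divide_right_mono) auto
    moreover have "1 / real k * y - h_lim (real u / real k) = (y - z) / real k"
      using assms(1) by (simp add: z_def field_simps)
    ultimately show ?thesis by simp
  qed
  show ?cartesian ?strong
    using close[of "log 2 (real c)"] close[of "log 2 (real b)"] mono
    by (simp_all add: b_def c_def n_def m_def)
qed

section \<open>Convergence in distribution\<close>

lemma continuous_on_lim_functions: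
  "continuous_on UNIV f_lim" "continuous_on UNIV g_lim" "continuous_on UNIV h_lim"
proof -
  show f: "continuous_on UNIV f_lim"
    unfolding f_lim_eq[abs_def] by (intro continuous_intros) simp_all
  show "continuous_on UNIV g_lim"
    unfolding g_lim_def[abs_def]
    by (intro continuous_intros continuous_on_compose2[OF f]) auto
  show "continuous_on UNIV h_lim"
    unfolding h_lim_eq[abs_def] by (intro continuous_intros) simp_all
qed

section \<open>Coupling of all discrete uniform variables with one continuous variable\<close>

definition unit_uniform :: "real measure" where
  "unit_uniform = uniform_measure lborel {0<..<1}"

lemma prob_space_unit_uniform: "prob_space unit_uniform"
  unfolding unit_uniform_def by (rule prob_space_uniform_measure) auto

lemma sets_unit_uniform [measurable_cong]: "sets unit_uniform = sets borel"
  by (simp add: unit_uniform_def)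

text \<open>The value \<open>u \<le> k\<close> is taken on an interval of length
  \<open>1 / (k + 1)\<close>. Squeezing the preimage between an open and a closed interval settles
  the endpoints.\<close>

lemma distr_floor_unit_uniform:
  "distr unit_uniform (count_space UNIV) (\<lambda>v. nat \<lfloor>real (Suc k) * v\<rfloor>) =
    measure_pmf (pmf_of_set {0..k})"
    (is "distr _ _ ?W = _")
proof (rule measure_eqI_countable[where A = UNIV])
  fix u :: nat
  have W: "?W \<in> borel \<rightarrow>\<^sub>M count_space UNIV"
    by measurable
  let ?A = "{0<..<1} \<inter> ?W -` {u}"
  have A: "?W -` {u} \<in> sets lborel"
    using measurable_sets[OF W, of "{u}"] by simp
  have "emeasure (distr unit_uniform (count_space UNIV) ?W) {u} = emeasure unit_uniform (?W -` {u})"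
    using W by (subst emeasure_distr) (auto simp: unit_uniform_def)
  also have "\<dots> = emeasure lborel ?A"
    unfolding unit_uniform_def using A by (subst emeasure_uniform_measure) (auto simp: divide_ennreal_def)
  also have "\<dots> = emeasure (measure_pmf (pmf_of_set {0..k})) {u}"
  proof (cases "u \<le> k")
    case True
    let ?l = "real u / real (Suc k)" and ?r = "(real u + 1) / real (Suc k)"
    have iff: "?W v = u \<longleftrightarrow> real u \<le> real (Suc k) * v \<and> real (Suc k) * v < real u + 1"
      if "0 < v" for v
    proof -
      have "0 \<le> real (Suc k) * v" using that by simp
      then show ?thesis by linarith
    qed
    have sub: "?A \<subseteq> {?l..?r}"
    proof
      fix v assume "v \<in> ?A"
      then have "real u \<le> real (Suc k) * v" "real (Suc k) * v < real u + 1"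
        using iff[of v] by auto
      then show "v \<in> {?l..?r}" by (auto simp: field_simps)
    qed
    have sup: "{?l<..<?r} \<subseteq> ?A"
    proof
      fix v assume v: "v \<in> {?l<..<?r}"
      then have *: "real u < real (Suc k) * v" "real (Suc k) * v < real u + 1"
        by (auto simp: field_simps)
      have "0 \<le> ?l" by simp
      with v have v0: "0 < v" by (meson greaterThanLessThan_iff le_less_trans)
      have "?r \<le> 1" using True by simp
      with v have "v < 1" by (meson greaterThanLessThan_iff less_le_trans)
      with * v0 iff[of v] show "v \<in> ?A" by auto
    qed
    have le: "?l \<le> ?r" by (intro divide_right_mono) auto
    have diff: "?r - ?l = 1 / real (Suc k)" by (simp add: field_simps)
    have "emeasure lborel ?A \<le> ennreal (1 / real (Suc k))"
      using emeasure_mono[OF sub, of lborel] le diff by simp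
    moreover have "ennreal (1 / real (Suc k)) \<le> emeasure lborel ?A"
      using emeasure_mono[OF sup, of lborel] A le diff by simp
    ultimately have "emeasure lborel ?A = ennreal (1 / real (Suc k))" by simp
    then show ?thesis
      using True by (simp add: emeasure_pmf_single)
  next
    case False
    have "?A = {}"
    proof (rule equals0I)
      fix v assume v: "v \<in> ?A"
      then have "real (Suc k) * v < real (Suc k) * 1" by (intro mult_strict_left_mono) auto
      then have "\<lfloor>real (Suc k) * v\<rfloor> < int (Suc k)" by (simp add: floor_less_iff)
      then have "?W v \<le> k" by linarith
      with v False show False by simp
    qed
    then show ?thesis
      using False by (simp add: emeasure_pmf_single)
  qed
  finally show "emeasure (distr unit_uniform (count_space UNIV) ?W) {u} =
    emeasure (measure_pmf (pmf_of_set {0..k})) {u}" .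
qed auto

lemma uniform_floor_ratio_tendsto:
  fixes v :: real
  assumes "0 < v"
  shows "(\<lambda>k. real (nat \<lfloor>real (Suc (Suc k)) * v\<rfloor>) / real (Suc k)) \<longlonglongrightarrow> v"
proof (rule tendsto_sandwich)
  have bounds: "real (Suc (Suc k)) * v - 1 \<le> real (nat \<lfloor>real (Suc (Suc k)) * v\<rfloor>)"
    "real (nat \<lfloor>real (Suc (Suc k)) * v\<rfloor>) \<le> real (Suc (Suc k)) * v" for k
  proof -
    have "0 \<le> real (Suc (Suc k)) * v" using assms by simp
    then show "real (Suc (Suc k)) * v - 1 \<le> real (nat \<lfloor>real (Suc (Suc k)) * v\<rfloor>)"
      "real (nat \<lfloor>real (Suc (Suc k)) * v\<rfloor>) \<le> real (Suc (Suc k)) * v"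
      by linarith+
  qed
  show "\<forall>\<^sub>F k in sequentially. (real (Suc (Suc k)) * v - 1) / real (Suc k)
      \<le> real (nat \<lfloor>real (Suc (Suc k)) * v\<rfloor>) / real (Suc k)"
    by (intro always_eventually allI divide_right_mono bounds) auto
  show "\<forall>\<^sub>F k in sequentially. real (nat \<lfloor>real (Suc (Suc k)) * v\<rfloor>) / real (Suc k)
      \<le> real (Suc (Suc k)) * v / real (Suc k)"
    by (intro always_eventually allI divide_right_mono bounds) auto
qed real_asymp+

text \<open>The indices are shifted by one because nothing is assumed about the law of \<open>U 0\<close>.\<close>

lemma weak_conv_m_unit_uniform:
  fixes T :: "nat \<Rightarrow> nat \<Rightarrow> real" and F :: "real \<Rightarrow> real"
  assumes F: "continuous_on UNIV F"
    and T: "\<And>k u. 1 \<le> k \<Longrightarrow> u \<le> k \<Longrightarrow> \<bar>T k u - F (real u / real k)\<bar> \<le> C / real k"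
  shows "weak_conv_m
    (\<lambda>k. distr unit_uniform borel (\<lambda>v. T (Suc k) (nat \<lfloor>real (Suc (Suc k)) * v\<rfloor>)))
    (distr unit_uniform borel F)"
proof -
  let ?W = "\<lambda>k v. nat \<lfloor>real (Suc (Suc k)) * v\<rfloor>"
  interpret Q: prob_space unit_uniform by (rule prob_space_unit_uniform)
  have [measurable]: "F \<in> borel_measurable borel"
    using F by (rule borel_measurable_continuous_onI)
  have TW [measurable]: "(\<lambda>v. T (Suc k) (?W k v)) \<in> borel_measurable unit_uniform" for k
    by (rule measurable_compose[where N = "count_space UNIV"]) measurable
  have lim: "(\<lambda>k. T (Suc k) (?W k v)) \<longlonglongrightarrow> F v" if v: "v \<in> {0<..<1}" for v
  proof -
    have "(\<lambda>k. F (real (?W k v) / real (Suc k))) \<longlonglongrightarrow> F v"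
      using F v uniform_floor_ratio_tendsto[of v]
      by (intro isCont_tendsto_compose[of v F]) (auto simp: continuous_on_eq_continuous_at)
    \<comment> \<open>The error bound \<open>T\<close> applies because \<open>v < 1\<close> forces
      \<open>?W k v \<le> Suc k\<close>.\<close>
    moreover have "(\<lambda>k. T (Suc k) (?W k v) - F (real (?W k v) / real (Suc k))) \<longlonglongrightarrow> 0"
    proof (rule Lim_null_comparison)
      have W: "?W k v \<le> Suc k" for k
      proof -
        have "real (Suc (Suc k)) * v < real (Suc (Suc k)) * 1"
          using v by (intro mult_strict_left_mono) auto
        then have "\<lfloor>real (Suc (Suc k)) * v\<rfloor> < int (Suc (Suc k))"
          by (simp add: floor_less_iff)
        then show ?thesis by linarith
      qed
      show "\<forall>\<^sub>F k in sequentially.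
          norm (T (Suc k) (?W k v) - F (real (?W k v) / real (Suc k))) \<le> C / real (Suc k)"
        unfolding real_norm_def by (intro always_eventually allI T W) simp
      show "(\<lambda>k. C / real (Suc k)) \<longlonglongrightarrow> 0" by real_asymp
    qed
    ultimately show ?thesis
      using tendsto_add by fastforce
  qed
  show ?thesis
  \<comment> \<open>Test functions are bounded by 1, so pointwise convergence on the full-measure
    set \<open>{0<..<1}\<close> passes to integrals by dominated convergence.\<close>
  proof (rule integral_bdd_continuous_conv_imp_weak_conv)
    fix \<phi> :: "real \<Rightarrow> real"
    assume \<phi>: "\<And>x. isCont \<phi> x" "\<And>x. \<bar>\<phi> x\<bar> \<le> 1"
    have [measurable]: "\<phi> \<in> borel_measurable borel"
      using \<phi>(1) by (intro borel_measurable_continuous_onI) (simp add: continuous_on_eq_continuous_at)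
    have "(\<lambda>k. \<integral>v. \<phi> (T (Suc k) (?W k v)) \<partial>unit_uniform) \<longlonglongrightarrow> (\<integral>v. \<phi> (F v) \<partial>unit_uniform)"
    proof (rule integral_dominated_convergence[where w = "\<lambda>_. 1"])
      show "AE v in unit_uniform. (\<lambda>k. \<phi> (T (Suc k) (?W k v))) \<longlonglongrightarrow> \<phi> (F v)"
        unfolding unit_uniform_def
        by (intro AE_uniform_measureI AE_I2 impI isCont_tendsto_compose[OF \<phi>(1)] lim) simp_all
    qed (use \<phi>(2) in \<open>auto simp: Q.integrable_const\<close>)
    then show "(\<lambda>k. \<integral>x. \<phi> x \<partial>distr unit_uniform borel (\<lambda>v. T (Suc k) (?W k v)))
        \<longlonglongrightarrow> (\<integral>x. \<phi> x \<partial>distr unit_uniform borel F)"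
      by (simp add: integral_distr)
  qed (auto intro!: Q.real_distribution_distr)
qed

text \<open>Weak convergence depends on laws alone, so the \<open>U k\<close>, living on unrelated
  spaces, may be replaced by the coupled variables.\<close>

lemma weak_conv_m_uniform_approx:
  fixes T :: "nat \<Rightarrow> nat \<Rightarrow> real" and F :: "real \<Rightarrow> real"
    and M :: "nat \<Rightarrow> 'a measure" and U :: "nat \<Rightarrow> 'a \<Rightarrow> nat"
    and N :: "'b measure" and V :: "'b \<Rightarrow> real"
  assumes "\<And>k. k \<ge> 1 \<Longrightarrow> U k \<in> measurable (M k) (count_space UNIV)"
    and "\<And>k. k \<ge> 1 \<Longrightarrow> distr (M k) (count_space UNIV) (U k) = measure_pmf (pmf_of_set {0..k})"
    and "V \<in> borel_measurable N"
    and "distr N borel V = uniform_measure lborel {0<..<1}"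
    and F: "continuous_on UNIV F"
    and T: "\<And>k u. 1 \<le> k \<Longrightarrow> u \<le> k \<Longrightarrow> \<bar>T k u - F (real u / real k)\<bar> \<le> C / real k"
  shows "weak_conv_m (\<lambda>k. distr (M k) borel (\<lambda>\<omega>. T k (U k \<omega>))) (distr N borel (\<lambda>\<omega>. F (V \<omega>)))"
proof -
  let ?W = "\<lambda>k v. nat \<lfloor>real (Suc (Suc k)) * v\<rfloor>"
  have [measurable]: "F \<in> borel_measurable borel"
    using F by (rule borel_measurable_continuous_onI)
  have eq: "distr (M (Suc k)) borel (\<lambda>\<omega>. T (Suc k) (U (Suc k) \<omega>)) =
      distr unit_uniform borel (\<lambda>v. T (Suc k) (?W k v))" for k
  proof -
    have "distr (M (Suc k)) borel (\<lambda>\<omega>. T (Suc k) (U (Suc k) \<omega>)) =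
        distr (distr (M (Suc k)) (count_space UNIV) (U (Suc k))) borel (T (Suc k))"
      using assms(1)[of "Suc k"] by (subst distr_distr) (auto simp: comp_def)
    also have "distr (M (Suc k)) (count_space UNIV) (U (Suc k)) =
        distr unit_uniform (count_space UNIV) (?W k)"
      using assms(2)[of "Suc k"] by (simp only: distr_floor_unit_uniform)
    also have "distr \<dots> borel (T (Suc k)) = distr unit_uniform borel (\<lambda>v. T (Suc k) (?W k v))"
      by (subst distr_distr) (auto simp: comp_def)
    finally show ?thesis .
  qed
  have eqV: "distr N borel (\<lambda>\<omega>. F (V \<omega>)) = distr unit_uniform borel F"
    unfolding unit_uniform_def assms(4)[symmetric]
    using assms(3) by (subst distr_distr) (auto simp: comp_def)
  have "weak_conv_m (\<lambda>k. distr (M (Suc k)) borel (\<lambda>\<omega>. T (Suc k) (U (Suc k) \<omega>)))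
      (distr N borel (\<lambda>\<omega>. F (V \<omega>)))"
    unfolding eq eqV using F T by (rule weak_conv_m_unit_uniform)
  \<comment> \<open>Weak convergence unfolds to convergence of distribution functions, where the
    index shift is removed pointwise.\<close>
  then show ?thesis
    unfolding weak_conv_m_def weak_conv_def
    by (auto intro: filterlim_sequentially_Suc[THEN iffD1])
qed

theorem theoremA3:
  fixes M :: "nat \<Rightarrow> 'a measure" and U :: "nat \<Rightarrow> 'a \<Rightarrow> nat"
    and X Y :: "nat \<Rightarrow> 'a \<Rightarrow> nat"
    and N :: "'b measure" and V :: "'b \<Rightarrow> real"
  assumes "\<And>k. k \<ge> 1 \<Longrightarrow> prob_space (M k)"
    and "\<And>k. k \<ge> 1 \<Longrightarrow> U k \<in> measurable (M k) (count_space UNIV)"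
    and "\<And>k. k \<ge> 1 \<Longrightarrow> distr (M k) (count_space UNIV) (U k) = measure_pmf (pmf_of_set {0..k})"
    and "\<And>k \<omega>. X k \<omega> = 2 ^ U k \<omega>"
    and "\<And>k \<omega>. Y k \<omega> = 2 ^ (k - U k \<omega>)"
    and "prob_space N"
    and "V \<in> borel_measurable N"
    and "distr N borel V = uniform_measure lborel {0<..<1}"
  shows
    "weak_conv_m
       (\<lambda>k. distr (M k) borel
          (\<lambda>\<omega>. 1 / real k * log 2 (real (burning_number (comb_graph (X k \<omega>) (Y k \<omega>))))))
       (distr N borel (\<lambda>\<omega>. f_lim (V \<omega>)))
   \<and> weak_conv_m
       (\<lambda>k. distr (M k) borel
          (\<lambda>\<omega>. 1 / real k * log 2 (real (min (burning_number (comb_graph (X k \<omega>) (Y k \<omega>)))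
                                              (burning_number (comb_graph (Y k \<omega>) (X k \<omega>)))))))
       (distr N borel (\<lambda>\<omega>. g_lim (V \<omega>)))
   \<and> weak_conv_m
       (\<lambda>k. distr (M k) borel
          (\<lambda>\<omega>. 1 / real k * log 2 (real (burning_number
             (cartesian_product (path_graph (X k \<omega>)) (path_graph (Y k \<omega>)))))))
       (distr N borel (\<lambda>\<omega>. h_lim (V \<omega>)))
   \<and> weak_conv_m
       (\<lambda>k. distr (M k) borel
          (\<lambda>\<omega>. 1 / real k * log 2 (real (burning_number
             (strong_product (path_graph (X k \<omega>)) (path_graph (Y k \<omega>)))))))
       (distr N borel (\<lambda>\<omega>. h_lim (V \<omega>)))"
proof -
  \<comment> \<open>The constant 4 is the common error of the logarithmic estimates.\<close>
  note conv = weak_conv_m_uniform_approx[OF assms(2,3,7,8), where C = 4]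
  show ?thesis
    unfolding assms(4,5)
    using conv[OF _ _ continuous_on_lim_functions(1) log_burning_number_comb]
      conv[OF _ _ continuous_on_lim_functions(2) log_burning_number_comb_min]
      conv[OF _ _ continuous_on_lim_functions(3) log_burning_number_grid(1)]
      conv[OF _ _ continuous_on_lim_functions(3) log_burning_number_grid(2)]
    by blast
qed

end
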